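(* For every information setting $k\in\{F,P^+,P^-,N\}$, the expected reward $R^{(k)}=\mathbb{E}\big[R^{(k)}(\mathbf{S},\Lambda)\big]$ to be paid by the source is $$R^{(k)} = c_d+\sum_{i=1}^{N}\mathcal{C}_{r_i},\qquad \mathcal{C}_{r_i}=c_r+c_s\,\mathbb{E}(T_d^{r_i}).$$
   Context: Network model. A source, a destination and $N$ relays $r_1,\dots,r_N$. For each relay $r$, the inter-contact time with the source (resp. destination) is a nonnegative random variable $\tilde T_s^{r}$ (resp. $\tilde T_d^{r}$) whose distribution may depend on $r$. A message is generated at time $0$. Relay $r$ meets the source at time $T_s^{r}$ and, after that, meets the destination $T_d^{r}$ time units later, i.e. at time $T_s^{r}+T_d^{r}$. Here $T_s^{r}$ (resp. $T_d^{r}$) has the residual-life distribution of $\tilde T_s^{r}$ (resp. $\tilde T_d^{r}$), i.e. the distribution on $[0,\infty)$ with density $x\mapsto \mathbb{P}(\tilde T>x)/\mathbb{E}[\tilde T]$ and mean $\mathbb{E}[\tilde T^2]/(2\mathbb{E}[\tilde T])$. The $2N$ variables $T_s^{r},T_d^{r}$ are independent. All relays accept the message when they meet the source (two-hop routing: only contacts with the source or the destination matter). Order of contacts. $S_1<\dots<S_N$ are the increasingly ordered values of $T_s^{r_1},\dots,T_s^{r_N}$, $\mathbf{S}=(S_1,\dots,S_N)$, and $\Lambda$ is the (a.s. unique) ordering of the relays in which they meet the source: $\Lambda(i)$ is the relay meeting the source at time $S_i$. $W$ denotes the (a.s. unique) relay that is first to meet the destination with the message, i.e. the relay minimizing $T_s^{r}+T_d^{r}$.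 Only $W$ is rewarded. Actual success probability. For $\mathbf{s}=(s_1<\dots<s_N)$ and an ordering $\ell$ of the relays, $$p_i(\mathbf{s},\ell)=\mathbb{P}\big(s_i+T_d^{\ell(i)}<s_j+T_d^{\ell(j)}\ \text{for all } j\ne i\big)=\mathbb{P}\big(W=\ell(i)\mid \mathbf{S}=\mathbf{s},\Lambda=\ell\big).$$ Estimated success probabilities. $p_i^{(k)}(\mathbf{s},\ell)$ is the success probability estimated by the $i$-th relay to meet the source, on the basis of the information available to it in setting $k$ (all distributions are known to all relays): - Full information: $p_i^{(F)}(\mathbf{S},\Lambda)=\mathbb{P}(W=\Lambda(i)\mid \Lambda(1),\dots,\Lambda(i),S_1,\dots,S_i)$. - Partial information with identities: $p_i^{(P^+)}(\mathbf{S},\Lambda)=\mathbb{P}(W=\Lambda(i)\mid \Lambda(1),\dots,\Lambda(i),S_i)$. - Partial information without identities (the relay knows only its own identity, its rank $i$ and its own meeting time): $p_i^{(P^-)}(\mathbf{S},\Lambda)=\mathbb{P}(W=\Lambda(i)\mid \Lambda(i),S_i)$. - No information (the relay knows only its own identity and its meeting time): $p_i^{(N)}(\mathbf{s},\ell)=q_{\ell(i)}(s_i)$, where $q_r(s)=\mathbb{P}(W=r\mid T_s^{r}=s)$. Costs and rewards. $c_r,c_s,c_d$ are the reception cost, the storage cost per time unit and the cost of transmitting to the destination. The net expected cost estimated by the $i$-th relay when it is promised the reward $R_i$ (paid only if it is first at the destination) is $c_r+c_s\mathbb{E}(T_d^{\ell(i)})+(c_d-R_i)\,p_i^{(k)}(\mathbf{s},\ell)$.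 The source promises the minimal reward making this nonpositive, namely $$R_i^{(k)}(\mathbf{s},\ell)=c_d+\mathcal{C}_{\ell(i)}/p_i^{(k)}(\mathbf{s},\ell),\qquad \mathcal{C}_{r}=c_r+c_s\,\mathbb{E}(T_d^{r}).$$ The expected reward paid by the source given $\mathbf{S}=\mathbf{s},\Lambda=\ell$ is $$R^{(k)}(\mathbf{s},\ell)=\sum_{i=1}^N p_i(\mathbf{s},\ell)R_i^{(k)}(\mathbf{s},\ell)=c_d+\sum_{i=1}^N\mathcal{C}_{\ell(i)}\,\frac{p_i(\mathbf{s},\ell)}{p_i^{(k)}(\mathbf{s},\ell)} .$$
   Formalization: Adds the assumption that each estimated success probability p_i^(k)(S,Λ) is almost surely positive for the given setting k; otherwise (e.g. some bounded inter-contact times) the reward c_d + C/p_i^(k) divides by zero and is undefined. Also N ≥ 1. *)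

theory Defs
  imports "HOL-Probability.Probability"
begin

text \<open>
  Density of the residual life of a nonnegative random variable \<open>X\<close> on the probability
  space \<open>P\<close>.
\<close>

definition residual_density :: "'b measure \<Rightarrow> ('b \<Rightarrow> real) \<Rightarrow> real \<Rightarrow> real" where
  "residual_density P X x =
     (if 0 \<le> x then measure P {\<omega> \<in> space P. X \<omega> > x} / (\<integral>\<omega>. X \<omega> \<partial>P) else 0)"

text \<open>
  The factorised conditional probability \<open>x \<mapsto> P(A | X = x)\<close>: the Radon-Nikodym derivative of
  \<open>B \<mapsto> P(A \<inter> {X \<in> B})\<close> with respect to the law of \<open>X\<close>. It is determined up to null sets of that
  law; the lemma below identifies it with the library's conditional expectation of the indicator
  of \<open>A\<close> given the sigma-algebra generated by \<open>X\<close>.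
\<close>

definition cond_prob_at :: "'a measure \<Rightarrow> 'a set \<Rightarrow> 'c measure \<Rightarrow> ('a \<Rightarrow> 'c) \<Rightarrow> 'c \<Rightarrow> real" where
  "cond_prob_at M A K X x =
     enn2real (RN_deriv (distr M K X) (distr (density M (indicator A)) K X) x)"

lemma (in prob_space) cond_prob_at_eq_real_cond_exp:
  assumes A[measurable]: "A \<in> events" and X[measurable]: "X \<in> measurable M K"
  shows "AE \<omega> in M. cond_prob_at M A K X (X \<omega>) =
           real_cond_exp M (vimage_algebra (space M) X K) (indicator A) \<omega>"
proof -
  define F where "F = vimage_algebra (space M) X K"
  define f where "f = RN_deriv (distr M K X) (distr (density M (indicator A)) K X)"
  have spX: "X \<in> space M \<rightarrow> space K" using measurable_space[OF X] by auto
  have setsF: "sets F = {X -` B \<inter> space M | B. B \<in> sets K}"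
    unfolding F_def by (rule sets_vimage_algebra2[OF spX])
  have subalg: "subalgebra M F"
    unfolding subalgebra_def setsF by (auto simp: F_def)
  have XF: "X \<in> measurable F K"
    unfolding F_def by (rule measurable_vimage_algebra1[OF spX])
  interpret F: finite_measure_subalgebra M F
    by standard (rule subalg)
  interpret D: prob_space "distr M K X" by (rule prob_space_distr[OF X])
  have f[measurable]: "f \<in> borel_measurable K"
    using borel_measurable_RN_deriv[of "distr M K X"] by (simp add: f_def)
  have em: "emeasure (distr (density M (indicator A)) K X) B = emeasure M (A \<inter> (X -` B \<inter> space M))"
    if [measurable]: "B \<in> sets K" for B
  proof -
    have "emeasure (distr (density M (indicator A)) K X) B =
          emeasure (density M (indicator A)) (X -` B \<inter> space M)"
      by (subst emeasure_distr) (use measurable_space[OF X] in simp_all)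
    also have "\<dots> = (\<integral>\<^sup>+\<omega>. indicator A \<omega> * indicator (X -` B \<inter> space M) \<omega> \<partial>M)"
      by (rule emeasure_density) measurable
    also have "\<dots> = (\<integral>\<^sup>+\<omega>. indicator (A \<inter> (X -` B \<inter> space M)) \<omega> \<partial>M)"
      by (simp only: indicator_inter_arith)
    also have "\<dots> = emeasure M (A \<inter> (X -` B \<inter> space M))"
      by (rule nn_integral_indicator) measurable
    finally show ?thesis .
  qed
  have "absolutely_continuous (distr M K X) (distr (density M (indicator A)) K X)"
    unfolding absolutely_continuous_def
  proof
    fix B assume "B \<in> null_sets (distr M K X)"
    then have B[measurable]: "B \<in> sets K" and "emeasure M (X -` B \<inter> space M) = 0"
      by (auto simp: null_sets_def emeasure_distr)
    then have "emeasure M (A \<inter> (X -` B \<inter> space M)) = 0"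
      using emeasure_mono[OF Int_lower2 measurable_sets[OF X B], of A] by simp
    then show "B \<in> null_sets (distr (density M (indicator A)) K X)"
      using B em[OF B] by (auto simp: null_sets_def)
  qed
  then have dens: "density (distr M K X) f = distr (density M (indicator A)) K X"
    unfolding f_def by (intro D.density_RN_deriv) auto
  have nn: "(\<integral>\<^sup>+\<omega>. f (X \<omega>) * indicator B (X \<omega>) \<partial>M) = emeasure M (A \<inter> (X -` B \<inter> space M))"
    if [measurable]: "B \<in> sets K" for B
  proof -
    have "(\<integral>\<^sup>+\<omega>. f (X \<omega>) * indicator B (X \<omega>) \<partial>M) = emeasure (density (distr M K X) f) B"
      by (simp add: emeasure_density nn_integral_distr)
    then show ?thesis by (simp add: dens em)
  qed
  have "(\<integral>\<^sup>+\<omega>. f (X \<omega>) \<partial>M) = (\<integral>\<^sup>+\<omega>. f (X \<omega>) * indicator (space K) (X \<omega>) \<partial>M)"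
    using measurable_space[OF X] by (intro nn_integral_cong) simp
  also have "\<dots> \<noteq> \<infinity>" by (simp add: nn)
  finally have fin: "(\<integral>\<^sup>+\<omega>. f (X \<omega>) \<partial>M) \<noteq> \<infinity>" .
  then have "AE \<omega> in M. f (X \<omega>) \<noteq> \<infinity>"
    by (intro nn_integral_PInf_AE) simp_all
  then have AEfin: "AE \<omega> in M. ennreal (enn2real (f (X \<omega>))) = f (X \<omega>)"
    by eventually_elim (simp add: less_top[symmetric])
  have int: "integrable M (\<lambda>\<omega>. enn2real (f (X \<omega>)))"
  proof (rule integrableI_nonneg)
    have "(\<integral>\<^sup>+\<omega>. ennreal (enn2real (f (X \<omega>))) \<partial>M) = (\<integral>\<^sup>+\<omega>. f (X \<omega>) \<partial>M)"
      using AEfin by (intro nn_integral_cong_AE)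
    then show "(\<integral>\<^sup>+\<omega>. ennreal (enn2real (f (X \<omega>))) \<partial>M) < \<infinity>"
      using fin by (simp add: less_top[symmetric])
  qed simp_all
  have "AE \<omega> in M. real_cond_exp M F (indicator A) \<omega> = enn2real (f (X \<omega>))"
  proof (rule F.real_cond_exp_charact)
    fix C assume "C \<in> sets F"
    then obtain B where B[measurable]: "B \<in> sets K" and C: "C = X -` B \<inter> space M"
      unfolding setsF by auto
    have "(\<integral>\<omega>\<in>C. enn2real (f (X \<omega>)) \<partial>M) =
          (\<integral>\<omega>. enn2real (f (X \<omega>) * indicator B (X \<omega>)) \<partial>M)"
      unfolding set_lebesgue_integral_def C
      by (intro Bochner_Integration.integral_cong) (auto simp: indicator_def)
    also have "\<dots> = enn2real (\<integral>\<^sup>+\<omega>. ennreal (enn2real (f (X \<omega>) * indicator B (X \<omega>))) \<partial>M)"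
      by (rule integral_eq_nn_integral) auto
    also have "\<dots> = enn2real (\<integral>\<^sup>+\<omega>. f (X \<omega>) * indicator B (X \<omega>) \<partial>M)"
    proof (intro arg_cong[where f = enn2real] nn_integral_cong_AE)
      show "AE \<omega> in M. ennreal (enn2real (f (X \<omega>) * indicator B (X \<omega>))) =
          f (X \<omega>) * indicator B (X \<omega>)"
        using AEfin by eventually_elim (simp split: split_indicator)
    qed
    also have "\<dots> = measure M (A \<inter> C)" by (simp add: nn C measure_def)
    also have "\<dots> = (\<integral>\<omega>\<in>C. indicator A \<omega> \<partial>M)"
    proof -
      have [measurable]: "C \<in> events" unfolding C by measurable
      have "(\<integral>\<omega>\<in>C. indicator A \<omega> \<partial>M) = (\<integral>\<omega>. indicat_real (A \<inter> C) \<omega> \<partial>M)"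
        unfolding set_lebesgue_integral_def
        by (intro Bochner_Integration.integral_cong) (auto simp: indicator_def)
      then show ?thesis by simp
    qed
    finally show "(\<integral>\<omega>\<in>C. indicator A \<omega> \<partial>M) = (\<integral>\<omega>\<in>C. enn2real (f (X \<omega>)) \<partial>M)" by simp
  next
    show "(\<lambda>\<omega>. enn2real (f (X \<omega>))) \<in> borel_measurable F"
      using XF f by measurable
  next
    show "integrable M (indicator A :: 'a \<Rightarrow> real)"
      by (rule integrable_real_indicator) (simp_all add: emeasure_eq_measure)
  qed (rule int)
  then show ?thesis
    unfolding cond_prob_at_def f_def[symmetric] F_def[symmetric] by eventually_elim simp
qed

datatype info_setting = Full | Partial_Ids | Partial_NoIds | No_Info

text \<open>
  Relay \<open>r\<close> is the index \<open>r \<in> {1..N}\<close>. The inter-contact times \<open>ICs r\<close> (with the source) and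
  \<open>ICd r\<close> (with the destination) live on a probability space \<open>P\<close> of their own, since only their
  laws matter. On \<open>M\<close>, relay \<open>r\<close> meets the source at time \<open>Ts r\<close> and then the destination at time
  \<open>Ts r + Td r\<close>.
\<close>

locale two_hop_network = prob_space M
  for M :: "'a measure" +
  fixes P :: "'b measure"
    and N :: nat
    and ICs ICd :: "nat \<Rightarrow> 'b \<Rightarrow> real"
    and Ts Td :: "nat \<Rightarrow> 'a \<Rightarrow> real"
  assumes N_pos: "N \<ge> 1"
    and P_prob: "prob_space P"
    and ICs_nonneg: "r \<in> {1..N} \<Longrightarrow> AE \<omega> in P. 0 \<le> ICs r \<omega>"
    and ICd_nonneg: "r \<in> {1..N} \<Longrightarrow> AE \<omega> in P. 0 \<le> ICd r \<omega>"
    and ICs_integrable: "r \<in> {1..N} \<Longrightarrow> integrable P (ICs r)"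
    and ICd_integrable: "r \<in> {1..N} \<Longrightarrow> integrable P (ICd r)"
    and ICs_mean_pos: "r \<in> {1..N} \<Longrightarrow> 0 < (\<integral>\<omega>. ICs r \<omega> \<partial>P)"
    and ICd_mean_pos: "r \<in> {1..N} \<Longrightarrow> 0 < (\<integral>\<omega>. ICd r \<omega> \<partial>P)"
    and ICd_square_integrable: "r \<in> {1..N} \<Longrightarrow> integrable P (\<lambda>\<omega>. (ICd r \<omega>)\<^sup>2)"
      \<comment> \<open>equivalent to finiteness of the mean of \<open>Td r\<close>\<close>
    and Ts_residual: "r \<in> {1..N} \<Longrightarrow> distributed M lborel (Ts r) (residual_density P (ICs r))"
    and Td_residual: "r \<in> {1..N} \<Longrightarrow> distributed M lborel (Td r) (residual_density P (ICd r))"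
    and indep: "indep_vars (\<lambda>_. borel) (case_sum Ts Td) ({1..N} <+> {1..N})"
begin

text \<open>
  \<open>contact_time \<omega> i\<close> is the i-th smallest meeting time with the source and \<open>contact_order \<omega> i\<close> the
  i-th relay to meet the source. Ties, here and in \<open>winner\<close>, form a null event; they are resolved
  in favour of the smaller index.
\<close>

definition contact_time :: "'a \<Rightarrow> nat \<Rightarrow> real" where
  "contact_time \<omega> i = sort (map (\<lambda>r. Ts r \<omega>) [1..<Suc N]) ! (i - 1)"

definition contact_order :: "'a \<Rightarrow> nat \<Rightarrow> nat" where
  "contact_order \<omega> i = sort_key (\<lambda>r. Ts r \<omega>) [1..<Suc N] ! (i - 1)"

definition winner :: "'a \<Rightarrow> nat" where
  "winner \<omega> = (LEAST r. r \<in> {1..N} \<and> (\<forall>j\<in>{1..N}. Ts r \<omega> + Td r \<omega> \<le> Ts j \<omega> + Td j \<omega>))"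

definition success_prob :: "nat \<Rightarrow> (nat \<Rightarrow> real) \<Rightarrow> (nat \<Rightarrow> nat) \<Rightarrow> real" where
  "success_prob i s l =
     prob {\<omega> \<in> space M. \<forall>j\<in>{1..N} - {i}. s i + Td (l i) \<omega> < s j + Td (l j) \<omega>}"

definition wins :: "nat \<Rightarrow> 'a set" where
  "wins i = {\<omega> \<in> space M. winner \<omega> = contact_order \<omega> i}"

definition q :: "nat \<Rightarrow> real \<Rightarrow> real" where
  "q r = cond_prob_at M {\<omega> \<in> space M. winner \<omega> = r} borel (Ts r)"

definition estimated_prob ::
  "info_setting \<Rightarrow> nat \<Rightarrow> (nat \<Rightarrow> real) \<Rightarrow> (nat \<Rightarrow> nat) \<Rightarrow> real" where
  "estimated_prob k i s l =
     (case k of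
        Full \<Rightarrow>
          cond_prob_at M (wins i)
            (PiM {1..i} (\<lambda>_. count_space UNIV) \<Otimes>\<^sub>M PiM {1..i} (\<lambda>_. borel))
            (\<lambda>\<omega>. (restrict (contact_order \<omega>) {1..i}, restrict (contact_time \<omega>) {1..i}))
            (restrict l {1..i}, restrict s {1..i})
      | Partial_Ids \<Rightarrow>
          cond_prob_at M (wins i)
            (PiM {1..i} (\<lambda>_. count_space UNIV) \<Otimes>\<^sub>M borel)
            (\<lambda>\<omega>. (restrict (contact_order \<omega>) {1..i}, contact_time \<omega> i))
            (restrict l {1..i}, s i)
      | Partial_NoIds \<Rightarrow>
          cond_prob_at M (wins i)
            (count_space UNIV \<Otimes>\<^sub>M borel)
            (\<lambda>\<omega>. (contact_order \<omega> i, contact_time \<omega> i))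
            (l i, s i)
      | No_Info \<Rightarrow> q (l i) (s i))"

definition relay_cost :: "real \<Rightarrow> real \<Rightarrow> nat \<Rightarrow> real" where
  "relay_cost c_r c_s r = c_r + c_s * expectation (Td r)"

text \<open>
  The reward is meaningful only where the estimated success probability is positive: with
  probability 0, no finite reward makes the net expected cost
  \<open>relay_cost c_r c_s (l i) + (c_d - R) * estimated_prob k i s l\<close> of a relay nonpositive when
  its cost is positive, while division by zero yields 0 here. Positivity has to be assumed: it can fail
  for bounded inter-contact times, when a late relay may be certain to lose.
\<close>

definition reward ::
  "real \<Rightarrow> real \<Rightarrow> real \<Rightarrow> info_setting \<Rightarrow> nat \<Rightarrow> (nat \<Rightarrow> real) \<Rightarrow> (nat \<Rightarrow> nat) \<Rightarrow> real" where
  "reward c_r c_s c_d k i s l = c_d + relay_cost c_r c_s (l i) / estimated_prob k i s l"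

definition expected_reward_given ::
  "real \<Rightarrow> real \<Rightarrow> real \<Rightarrow> info_setting \<Rightarrow> (nat \<Rightarrow> real) \<Rightarrow> (nat \<Rightarrow> nat) \<Rightarrow> real" where
  "expected_reward_given c_r c_s c_d k s l =
     (\<Sum>i=1..N. success_prob i s l * reward c_r c_s c_d k i s l)"

end

end

theory Submission
  imports Defs
begin

text \<open>
  Let \<open>G\<^sub>r\<close> be the conditional probability that relay \<open>r\<close> wins, given all meeting times with the
  source. The meeting times with the destination are independent of these and ties have
  probability 0, so replacing the event that \<open>r\<close> wins by \<open>G\<^sub>r\<close> preserves the integral against any
  function of the source times. The information \<open>X\<close> of a relay is such a function, and the estimated
  probability \<open>p\<close> is the conditional probability of the same event given \<open>X\<close>. Hence
  \<open>E[1\<^sub>D(X) G\<^sub>r / p(X)] = E[1\<^sub>D(X) p(X) / p(X)] = P(X \<in> D)\<close>. With \<open>D\<close> the event that \<open>r\<close> has rank \<open>i\<close>,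
  summation over \<open>i\<close> gives each relay the total weight 1. Without information the rank is not a function
  of \<open>X\<close>, but there \<open>p(X)\<close> does not depend on the rank, so one sums over \<open>i\<close> first and takes \<open>D\<close>
  to be everything.
\<close>

section \<open>Sorting by a key and its measurability\<close>

lemma insort_key_cong_on:
  "(\<And>z. z \<in> insert x (set zs) \<Longrightarrow> f z = g z) \<Longrightarrow> insort_key f x zs = insort_key g x zs"
  by (induction zs) auto

text \<open>Lets the random keys \<open>Ts r \<omega>\<close> be exchanged for a vector that agrees
  with them on the relays only.\<close>

lemma sort_key_cong_on:
  "(\<And>x. x \<in> set xs \<Longrightarrow> f x = g x) \<Longrightarrow> sort_key f xs = sort_key g xs"
proof (induction xs)
  case (Cons x xs)
  then have "sort_key f xs = sort_key g xs" by simp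
  moreover have "insort_key f x (sort_key g xs) = insort_key g x (sort_key g xs)"
    using Cons.prems by (intro insort_key_cong_on) simp
  ultimately show ?case by simp
qed simp

text \<open>The right-hand list is sorted and has the same multiset of entries as
  \<open>map f xs\<close>, which determines it. Thus the i-th smallest time belongs to the i-th
  relay, even when keys coincide.\<close>

lemma sort_map_eq_map_sort_key: "sort (map f xs) = map f (sort_key f xs)"
  by (rule properties_for_sort) simp_all

lemma measurable_insort_key:
  fixes f :: "'a \<Rightarrow> 'x::countable \<Rightarrow> real"
  assumes [measurable]: "\<And>x. (\<lambda>\<omega>. f \<omega> x) \<in> borel_measurable M"
  shows "(\<lambda>\<omega>. insort_key (f \<omega>) x zs) \<in> measurable M (count_space UNIV)"
proof (induction zs)
  case (Cons z zs)
  note Cons.IH[measurable]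
  show ?case by simp
qed simp

lemma measurable_sort_key:
  fixes f :: "'a \<Rightarrow> 'x::countable \<Rightarrow> real"
  assumes f: "\<And>x. (\<lambda>\<omega>. f \<omega> x) \<in> borel_measurable M"
  shows "(\<lambda>\<omega>. sort_key (f \<omega>) xs) \<in> measurable M (count_space UNIV)"
proof (induction xs)
  case (Cons x xs)
  \<comment> \<open>The list that receives \<open>x\<close> is itself random; its values lie in a
    countable type, so it may be treated as fixed, one value at a time.\<close>
  show ?case
    using measurable_compose_countable[OF measurable_insort_key[where f = f and x = x, OF f] Cons.IH]
    by simp
qed simp

text \<open>For \<open>j\<close> outside \<open>I\<close> the coordinate is constantly
  \<open>undefined\<close> on the product space. Having no condition on \<open>j\<close> permits
  coordinates at a random index, where every natural number has to be considered.\<close>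

lemma measurable_PiM_component_borel:
  "(\<lambda>y :: 'a \<Rightarrow> 'b::topological_space. y j) \<in> borel_measurable (PiM I (\<lambda>_. borel))"
proof (cases "j \<in> I")
  case False
  then have "(\<lambda>y :: 'a \<Rightarrow> 'b. y j) \<in> borel_measurable (PiM I (\<lambda>_. borel)) \<longleftrightarrow>
      (\<lambda>y :: 'a \<Rightarrow> 'b. undefined :: 'b) \<in> borel_measurable (PiM I (\<lambda>_. borel))"
    by (intro measurable_cong) (simp add: space_PiM PiE_arb[of _ I])
  then show ?thesis by simp
qed simp

section \<open>Conditional probability as a function of the observed value\<close>

lemma borel_measurable_cond_prob_at [measurable]:
  "cond_prob_at M A K X \<in> borel_measurable K"
proof -
  have "RN_deriv (distr M K X) (distr (density M (indicator A)) K X) \<in> borel_measurable K"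
    using borel_measurable_RN_deriv[of "distr M K X"] by simp
  then show ?thesis unfolding cond_prob_at_def[abs_def] by measurable
qed

lemma cond_prob_at_nonneg: "0 \<le> cond_prob_at M A K X x"
  by (simp add: cond_prob_at_def)

text \<open>The averaging property of conditional expectation, for nonnegative extended-valued
  weights \<open>h\<close>: weights that contain the reciprocal of an estimated probability are not
  known in advance to have finite integrals.\<close>

lemma (in prob_space) nn_integral_cond_prob_at:
  fixes h :: "'c \<Rightarrow> ennreal"
  assumes A[measurable]: "A \<in> events" and X[measurable]: "X \<in> measurable M K"
    and h[measurable]: "h \<in> borel_measurable K"
  shows "(\<integral>\<^sup>+\<omega>. h (X \<omega>) * ennreal (cond_prob_at M A K X (X \<omega>)) \<partial>M) =
    (\<integral>\<^sup>+\<omega>. h (X \<omega>) * indicator A \<omega> \<partial>M)"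
proof -
  define F where "F = vimage_algebra (space M) X K"
  have spX: "X \<in> space M \<rightarrow> space K" using measurable_space[OF X] by auto
  have subalg: "subalgebra M F"
    unfolding subalgebra_def F_def sets_vimage_algebra2[OF spX] by auto
  interpret F: finite_measure_subalgebra M F by standard (rule subalg)
  have XF[measurable]: "X \<in> measurable F K"
    unfolding F_def by (rule measurable_vimage_algebra1[OF spX])
  have zero: "AE \<omega> in M. 0 = nn_cond_exp M F (\<lambda>_. 0) \<omega>"
    using F.nn_cond_exp_F_meas[of "\<lambda>_. 0"] by simp
  have one: "AE \<omega> in M. 1 = nn_cond_exp M F (\<lambda>_. 1) \<omega>"
    using F.nn_cond_exp_F_meas[of "\<lambda>_. 1"] by simp
  have le: "AE \<omega> in M. nn_cond_exp M F (indicator A) \<omega> \<le> nn_cond_exp M F (\<lambda>_. 1) \<omega>"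
    by (rule F.nn_cond_exp_mono) (auto simp: indicator_def)
  have neg: "(\<lambda>x. ennreal (- indicator A x)) = (\<lambda>_. 0)"
    by (auto simp: fun_eq_iff indicator_def ennreal_neg)
  have pos: "(\<lambda>x. ennreal (indicator A x)) = indicator A"
    by (auto simp: fun_eq_iff indicator_def)
  \<comment> \<open>\<open>real_cond_exp\<close> is the difference of the conditional expectations
    of the positive and the negative part, converted to reals. Here the negative part is 0 and the
    positive part gives at most 1, so the conversion loses nothing.\<close>
  have AE: "AE \<omega> in M. ennreal (cond_prob_at M A K X (X \<omega>)) = nn_cond_exp M F (indicator A) \<omega>"
    using cond_prob_at_eq_real_cond_exp[OF A X, folded F_def] zero one le
  proof eventually_elim
    case (elim \<omega>)
    then have "nn_cond_exp M F (indicator A) \<omega> < top"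
      by (metis ennreal_one_less_top le_less_trans)
    with elim show ?case by (simp add: real_cond_exp_def neg pos)
  qed
  have "(\<integral>\<^sup>+\<omega>. h (X \<omega>) * ennreal (cond_prob_at M A K X (X \<omega>)) \<partial>M) =
      (\<integral>\<^sup>+\<omega>. h (X \<omega>) * nn_cond_exp M F (indicator A) \<omega> \<partial>M)"
    using AE by (intro nn_integral_cong_AE) auto
  also have "\<dots> = (\<integral>\<^sup>+\<omega>. h (X \<omega>) * indicator A \<omega> \<partial>M)"
    by (rule F.nn_cond_exp_intg) measurable
  finally show ?thesis .
qed

text \<open>By independence the joint law is a product. The law of \<open>X\<close> has a density,
  hence no atom at any fixed \<open>u\<close>; Fubini carries this over to the pair, whatever the
  law of \<open>U\<close>.\<close>

lemma (in prob_space) indep_var_distributed_AE_neq: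
  fixes X U :: "'a \<Rightarrow> real"
  assumes ind: "indep_var borel U borel X" and dens: "distributed M lborel X f"
  shows "AE \<omega> in M. U \<omega> \<noteq> X \<omega>"
proof -
  have X[measurable]: "X \<in> borel_measurable M" and U[measurable]: "U \<in> borel_measurable M"
    using ind by (auto dest: indep_var_rv1 indep_var_rv2)
  have dX: "distr M borel X = density lborel f"
    using dens by (auto simp: distributed_def cong: distr_cong)
  have [measurable]: "f \<in> borel_measurable borel"
    using dens by (auto simp: distributed_def)
  interpret DX: prob_space "distr M borel X" by (rule prob_space_distr[OF X])
  interpret DU: prob_space "distr M borel U" by (rule prob_space_distr[OF U])
  interpret PP: pair_prob_space "distr M borel U" "distr M borel X" ..
  have "AE u in distr M borel U. AE x in distr M borel X. u \<noteq> x"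
  proof (rule AE_I2)
    fix u :: real
    have "AE x in lborel. u \<noteq> x"
      using AE_lborel_singleton[of u] by eventually_elim auto
    then show "AE x in distr M borel X. u \<noteq> x"
      unfolding dX by (subst AE_density) auto
  qed
  moreover have "{p \<in> space (distr M borel U \<Otimes>\<^sub>M distr M borel X). fst p \<noteq> snd p}
      \<in> sets (distr M borel U \<Otimes>\<^sub>M distr M borel X)"
    by measurable
  ultimately have "AE p in distr M borel U \<Otimes>\<^sub>M distr M borel X. fst p \<noteq> snd p"
    using PP.AE_pair_iff[of "\<lambda>u x. u \<noteq> x"] by blast
  moreover have "distr M borel U \<Otimes>\<^sub>M distr M borel X = distr M (borel \<Otimes>\<^sub>M borel) (\<lambda>\<omega>. (U \<omega>, X \<omega>))"
    using ind unfolding indep_var_distribution_eq by blast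
  ultimately have "AE p in distr M (borel \<Otimes>\<^sub>M borel) (\<lambda>\<omega>. (U \<omega>, X \<omega>)). fst p \<noteq> snd p"
    by (simp only:)
  then show ?thesis by (subst (asm) AE_distr_iff) auto
qed


section \<open>Ranks and success as functions of the source times\<close>

context two_hop_network
begin

declare One_nat_def [simp del]

abbreviation "relays \<equiv> {1..N}"

text \<open>Cut off outside the relays so as to be a point of the product space over
  \<open>relays\<close>.\<close>

definition source_times :: "'a \<Rightarrow> nat \<Rightarrow> real" where
  "source_times \<omega> = (\<lambda>r\<in>relays. Ts r \<omega>)"

text \<open>This is \<open>contact_order\<close> with the randomness removed; with it the
  information of a relay becomes a deterministic function of the vector of source times.\<close>

definition order_of :: "(nat \<Rightarrow> real) \<Rightarrow> nat \<Rightarrow> nat" where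
  "order_of y i = sort_key y [1..<Suc N] ! (i - 1)"

text \<open>This is \<open>G\<^sub>r\<close> as a function of the source times \<open>y\<close>. It
  is indexed by the relay and not by its rank, so that it can be matched with the event that
  \<open>r\<close> wins.\<close>

definition relay_success :: "nat \<Rightarrow> (nat \<Rightarrow> real) \<Rightarrow> real" where
  "relay_success r y = prob {\<omega> \<in> space M. \<forall>j\<in>relays - {r}. y r + Td r \<omega> < y j + Td j \<omega>}"

abbreviation "times_space \<equiv> PiM relays (\<lambda>_. borel :: real measure)"

lemma Ts_measurable: "r \<in> relays \<Longrightarrow> Ts r \<in> borel_measurable M"
  using Ts_residual by (auto simp: distributed_def)

lemma Td_measurable: "r \<in> relays \<Longrightarrow> Td r \<in> borel_measurable M"
  using Td_residual by (auto simp: distributed_def)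

lemma source_times_measurable [measurable]: "source_times \<in> measurable M times_space"
  unfolding source_times_def[abs_def] by (intro measurable_restrict Ts_measurable)

lemma source_times_apply [simp]: "r \<in> relays \<Longrightarrow> source_times \<omega> r = Ts r \<omega>"
  by (simp add: source_times_def)

lemma order_of_measurable [measurable]: "(\<lambda>y. order_of y i) \<in> measurable times_space (count_space UNIV)"
proof -
  have "(\<lambda>y. sort_key y [1..<Suc N]) \<in> measurable times_space (count_space UNIV)"
    by (rule measurable_sort_key) (rule measurable_PiM_component_borel)
  then show ?thesis unfolding order_of_def by (rule measurable_compose) simp
qed

lemma nth_order_of_measurable [measurable]: "(\<lambda>y. y (order_of y i)) \<in> borel_measurable times_space"
  by (rule measurable_compose_countable[OF measurable_PiM_component_borel order_of_measurable])

lemma contact_order_eq: "contact_order \<omega> i = order_of (source_times \<omega>) i"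
proof -
  have "sort_key (\<lambda>r. Ts r \<omega>) [1..<Suc N] = sort_key (source_times \<omega>) [1..<Suc N]"
    by (rule sort_key_cong_on) auto
  then show ?thesis by (simp add: contact_order_def order_of_def)
qed

text \<open>Sorting permutes the list of relays, which is distinct. So this holds for every outcome,
  ties included, and sums over ranks can be reindexed pointwise.\<close>

lemma bij_betw_contact_order: "bij_betw (contact_order \<omega>) relays relays"
proof -
  let ?xs = "sort_key (\<lambda>r. Ts r \<omega>) [1..<Suc N]"
  \<comment> \<open>Ranks count from 1, list positions from 0.\<close>
  have "bij_betw (\<lambda>i. i - 1) relays {..<N}"
    by (rule bij_betw_byWitness[where f' = Suc]) auto
  moreover have "bij_betw ((!) ?xs) {..<N} relays"
    by (rule bij_betw_nth) auto
  ultimately have "bij_betw ((!) ?xs \<circ> (\<lambda>i. i - 1)) relays relays"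
    by (rule bij_betw_trans)
  then show ?thesis by (simp add: contact_order_def[abs_def] comp_def)
qed

lemma contact_order_in: "i \<in> relays \<Longrightarrow> contact_order \<omega> i \<in> relays"
  using bij_betw_contact_order[of \<omega>] by (auto simp: bij_betw_def)

lemma contact_order_surj:
  assumes "r \<in> relays"
  obtains i where "i \<in> relays" "contact_order \<omega> i = r"
  using bij_betw_contact_order[of \<omega>] assms by (metis bij_betw_imp_surj_on imageE)

lemma contact_time_eq: "i \<in> relays \<Longrightarrow> contact_time \<omega> i = Ts (contact_order \<omega> i) \<omega>"
  by (auto simp: contact_time_def contact_order_def sort_map_eq_map_sort_key simp del: upt_Suc)

lemma contact_time_eq_order_of:
  assumes "i \<in> relays"
  shows "contact_time \<omega> i = source_times \<omega> (order_of (source_times \<omega>) i)"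
  using contact_time_eq[OF assms] contact_order_in[OF assms, of \<omega>] by (simp add: contact_order_eq)

text \<open>The permutation \<open>contact_order \<omega>\<close> carries the other ranks to the
  other relays, so for given source times the success probability depends on the rank only through
  the relay that holds it.\<close>

lemma success_prob_eq:
  assumes i: "i \<in> relays"
  shows "success_prob i (contact_time \<omega>) (contact_order \<omega>) =
    relay_success (contact_order \<omega> i) (source_times \<omega>)"
proof -
  have im: "contact_order \<omega> ` (relays - {i}) = relays - {contact_order \<omega> i}"
    using inj_on_image_set_diff[of "contact_order \<omega>" relays relays "{i}"] bij_betw_contact_order[of \<omega>] i
    by (simp add: bij_betw_def)
  \<comment> \<open>The outcome \<open>\<omega>\<close> fixes the source times and the order; the
    probability is taken over \<open>\<omega>'\<close>, which enters through the destination times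
    only.\<close>
  have "(\<forall>j\<in>relays - {i}. contact_time \<omega> i + Td (contact_order \<omega> i) \<omega>'
          < contact_time \<omega> j + Td (contact_order \<omega> j) \<omega>') \<longleftrightarrow>
      (\<forall>j\<in>relays - {contact_order \<omega> i}. source_times \<omega> (contact_order \<omega> i)
          + Td (contact_order \<omega> i) \<omega>' < source_times \<omega> j + Td j \<omega>')" for \<omega>'
    unfolding im[symmetric] using i
    by (simp add: contact_time_eq source_times_apply[OF contact_order_in])
  then show ?thesis unfolding success_prob_def relay_success_def by simp
qed

section \<open>Independence and absence of ties\<close>

text \<open>The two vectors come from the disjoint blocks \<open>Inl\<close> and \<open>Inr\<close>
  of one independent family; the rest renames the indices back to relays.\<close>

lemma indep_source_destination:
  "indep_var times_space source_times times_space (\<lambda>\<omega>. \<lambda>r\<in>relays. Td r \<omega>)"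
proof -
  have "indep_var (PiM (Inl ` relays) (\<lambda>_. borel)) (\<lambda>\<omega>. restrict (\<lambda>i. case_sum Ts Td i \<omega>) (Inl ` relays))
      (PiM (Inr ` relays) (\<lambda>_. borel)) (\<lambda>\<omega>. restrict (\<lambda>i. case_sum Ts Td i \<omega>) (Inr ` relays))"
    by (rule indep_var_restrict[OF indep]) auto
  moreover have "(\<lambda>x. \<lambda>r\<in>relays. x (Inl r)) \<in> measurable (PiM (Inl ` relays) (\<lambda>_. borel)) times_space"
    by (intro measurable_restrict measurable_component_singleton) auto
  moreover have "(\<lambda>x. \<lambda>r\<in>relays. x (Inr r)) \<in> measurable (PiM (Inr ` relays) (\<lambda>_. borel)) times_space"
    by (intro measurable_restrict measurable_component_singleton) auto
  ultimately have "indep_var times_space ((\<lambda>x. \<lambda>r\<in>relays. x (Inl r)) \<circ>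
        (\<lambda>\<omega>. restrict (\<lambda>i. case_sum Ts Td i \<omega>) (Inl ` relays)))
      times_space ((\<lambda>x. \<lambda>r\<in>relays. x (Inr r)) \<circ>
        (\<lambda>\<omega>. restrict (\<lambda>i. case_sum Ts Td i \<omega>) (Inr ` relays)))"
    by (rule indep_var_compose)
  also have "(\<lambda>x. \<lambda>r\<in>relays. x (Inl r)) \<circ>
      (\<lambda>\<omega>. restrict (\<lambda>i. case_sum Ts Td i \<omega>) (Inl ` relays)) = source_times"
    by (auto simp: fun_eq_iff source_times_def restrict_def)
  also have "(\<lambda>x. \<lambda>r\<in>relays. x (Inr r)) \<circ>
      (\<lambda>\<omega>. restrict (\<lambda>i. case_sum Ts Td i \<omega>) (Inr ` relays)) = (\<lambda>\<omega>. \<lambda>r\<in>relays. Td r \<omega>)"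
    by (auto simp: fun_eq_iff restrict_def)
  finally show ?thesis .
qed

text \<open>A tie means \<open>Ts r \<omega> = Ts j \<omega> + Td j \<omega> - Td r
  \<omega>\<close>. The right side is built from other members of the independent family, hence is
  independent of \<open>Ts r\<close>, which has a density.\<close>

lemma AE_delivery_times_distinct:
  assumes r: "r \<in> relays" and j: "j \<in> relays" and "r \<noteq> j"
  shows "AE \<omega> in M. Ts r \<omega> + Td r \<omega> \<noteq> Ts j \<omega> + Td j \<omega>"
proof -
  let ?A = "{Inl j, Inr j, Inr r} :: (nat + nat) set" and ?B = "{Inl r} :: (nat + nat) set"
  have "indep_var (PiM ?A (\<lambda>_. borel)) (\<lambda>\<omega>. restrict (\<lambda>i. case_sum Ts Td i \<omega>) ?A)
      (PiM ?B (\<lambda>_. borel)) (\<lambda>\<omega>. restrict (\<lambda>i. case_sum Ts Td i \<omega>) ?B)"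
    by (rule indep_var_restrict[OF indep]) (use assms in auto)
  moreover have "(\<lambda>x. x (Inl j) + x (Inr j) - x (Inr r)) \<in> borel_measurable (PiM ?A (\<lambda>_. borel :: real measure))"
    by (intro borel_measurable_add borel_measurable_diff measurable_PiM_component_borel)
  moreover have "(\<lambda>x. x (Inl r)) \<in> borel_measurable (PiM ?B (\<lambda>_. borel :: real measure))"
    by (rule measurable_PiM_component_borel)
  ultimately have "indep_var borel ((\<lambda>x. x (Inl j) + x (Inr j) - x (Inr r)) \<circ>
        (\<lambda>\<omega>. restrict (\<lambda>i. case_sum Ts Td i \<omega>) ?A))
      borel ((\<lambda>x. x (Inl r)) \<circ> (\<lambda>\<omega>. restrict (\<lambda>i. case_sum Ts Td i \<omega>) ?B))"
    by (rule indep_var_compose)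
  also have "(\<lambda>x. x (Inl r)) \<circ> (\<lambda>\<omega>. restrict (\<lambda>i. case_sum Ts Td i \<omega>) ?B) = Ts r"
    by (auto simp: fun_eq_iff)
  finally have "AE \<omega> in M. ((\<lambda>x. x (Inl j) + x (Inr j) - x (Inr r)) \<circ>
        (\<lambda>\<omega>. restrict (\<lambda>i. case_sum Ts Td i \<omega>) ?A)) \<omega> \<noteq> Ts r \<omega>"
    by (rule indep_var_distributed_AE_neq) (rule Ts_residual[OF r])
  then show ?thesis by eventually_elim (auto simp: algebra_simps)
qed

lemma winner_props:
  shows winner_in: "winner \<omega> \<in> relays"
    and winner_le: "j \<in> relays \<Longrightarrow>
      Ts (winner \<omega>) \<omega> + Td (winner \<omega>) \<omega> \<le> Ts j \<omega> + Td j \<omega>"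
proof -
  let ?f = "\<lambda>r. Ts r \<omega> + Td r \<omega>"
  have ne: "relays \<noteq> {}" using N_pos by auto
  have "\<exists>r. is_arg_min ?f (\<lambda>r. r \<in> relays) r"
    by (rule ex_is_arg_min_if_finite) (use ne in auto)
  then have "\<exists>r. r \<in> relays \<and> (\<forall>j\<in>relays. ?f r \<le> ?f j)"
    by (auto simp: is_arg_min_linorder)
  then have "winner \<omega> \<in> relays \<and> (\<forall>j\<in>relays. ?f (winner \<omega>) \<le> ?f j)"
    unfolding winner_def by (rule LeastI_ex)
  then show "winner \<omega> \<in> relays" "j \<in> relays \<Longrightarrow> ?f (winner \<omega>) \<le> ?f j" by auto
qed

lemma winner_measurable [measurable]: "winner \<in> measurable M (count_space UNIV)"
proof -
  note Ts_measurable[measurable] Td_measurable[measurable]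
  show ?thesis unfolding winner_def[abs_def] by measurable
qed

text \<open>\<open>winner\<close> compares weakly and breaks ties by index, while success asks for
  strict inequalities; the two agree off the null event of a tie.\<close>

lemma AE_winner_iff:
  assumes r: "r \<in> relays"
  shows "AE \<omega> in M. winner \<omega> = r \<longleftrightarrow>
    (\<forall>j\<in>relays - {r}. Ts r \<omega> + Td r \<omega> < Ts j \<omega> + Td j \<omega>)"
proof -
  have "AE \<omega> in M. \<forall>j\<in>relays - {r}. Ts r \<omega> + Td r \<omega> \<noteq> Ts j \<omega> + Td j \<omega>"
    by (intro AE_finite_allI) (use r AE_delivery_times_distinct in auto)
  then show ?thesis
  proof eventually_elim
    case (elim \<omega>)
    then show ?case
      using winner_in[of \<omega>] winner_le[of r \<omega>] winner_le[of _ \<omega>] r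
      by (metis DiffD1 DiffI leD order_le_less singletonD)
  qed
qed

section \<open>Replacing the winning event by its conditional probability\<close>

lemma relay_success_nonneg: "0 \<le> relay_success r y"
  by (simp add: relay_success_def)

text \<open>Written against the law of the destination times, the probability takes the form of the
  inner integral in Fubini's theorem.\<close>

lemma relay_success_eq_integral:
  assumes r: "r \<in> relays"
  shows "ennreal (relay_success r y) = (\<integral>\<^sup>+z. indicator {z. \<forall>j\<in>relays - {r}. y r + z r < y j + z j} z
    \<partial>distr M times_space (\<lambda>\<omega>. \<lambda>r\<in>relays. Td r \<omega>))"
proof -
  note Td_measurable[measurable]
  have "ennreal (relay_success r y) =
      (\<integral>\<^sup>+\<omega>. indicator {\<omega> \<in> space M. \<forall>j\<in>relays - {r}. y r + Td r \<omega> < y j + Td j \<omega>} \<omega> \<partial>M)"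
    unfolding relay_success_def using r by (subst nn_integral_indicator) (auto simp: emeasure_eq_measure)
  also have "\<dots> = (\<integral>\<^sup>+\<omega>. indicator {z. \<forall>j\<in>relays - {r}. y r + z r < y j + z j} (\<lambda>r\<in>relays. Td r \<omega>) \<partial>M)"
    using r by (intro nn_integral_cong) (auto simp: indicator_def)
  also have "\<dots> = (\<integral>\<^sup>+z. indicator {z. \<forall>j\<in>relays - {r}. y r + z r < y j + z j} z
    \<partial>distr M times_space (\<lambda>\<omega>. \<lambda>r\<in>relays. Td r \<omega>))"
  proof (rule nn_integral_distr[symmetric, of _ M times_space])
    show "(\<lambda>\<omega>. \<lambda>r\<in>relays. Td r \<omega>) \<in> measurable M times_space"
      by (intro measurable_restrict Td_measurable)
    note measurable_PiM_component_borel[measurable]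
    have "Measurable.pred times_space (\<lambda>z. \<forall>j\<in>relays - {r}. y r + z r < y j + z j)"
      by measurable
    then show "(\<lambda>z. indicator {z. \<forall>j\<in>relays - {r}. y r + z r < y j + z j} z :: ennreal)
        \<in> borel_measurable (distr M times_space (\<lambda>\<omega>. \<lambda>r\<in>relays. Td r \<omega>))"
      by measurable
  qed
  finally show ?thesis .
qed

text \<open>By independence the joint law of the two time vectors is a product, so the destination
  times can be integrated out first. This makes \<open>relay_success r\<close> the conditional
  probability that \<open>r\<close> wins, given the source times.\<close>

lemma nn_integral_relay_success:
  fixes h :: "(nat \<Rightarrow> real) \<Rightarrow> ennreal"
  assumes r: "r \<in> relays" and h[measurable]: "h \<in> borel_measurable times_space"
  shows "(\<integral>\<^sup>+\<omega>. h (source_times \<omega>) * ennreal (relay_success r (source_times \<omega>)) \<partial>M) =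
    (\<integral>\<^sup>+\<omega>. h (source_times \<omega>) * indicator {\<omega> \<in> space M. winner \<omega> = r} \<omega> \<partial>M)"
proof -
  define Z where "Z \<omega> = (\<lambda>r\<in>relays. Td r \<omega>)" for \<omega>
  have Z[measurable]: "Z \<in> measurable M times_space"
    unfolding Z_def[abs_def] by (intro measurable_restrict Td_measurable)
  let ?first = "\<lambda>y z :: nat \<Rightarrow> real. \<forall>j\<in>relays - {r}. y r + z r < y j + z j"
  let ?g = "\<lambda>p. h (fst p) * indicator {p. ?first (fst p) (snd p)} p"
  interpret DZ: prob_space "distr M times_space Z" by (rule prob_space_distr) (rule Z)
  have [measurable]: "(\<lambda>y. y j) \<in> borel_measurable times_space" for j
    by (rule measurable_PiM_component_borel)
  have [measurable]: "Measurable.pred (times_space \<Otimes>\<^sub>M times_space) (\<lambda>p. ?first (fst p) (snd p))"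
    by measurable
  have g: "?g \<in> borel_measurable (times_space \<Otimes>\<^sub>M times_space)"
    by measurable
  have eq: "distr M times_space source_times \<Otimes>\<^sub>M distr M times_space Z =
      distr M (times_space \<Otimes>\<^sub>M times_space) (\<lambda>\<omega>. (source_times \<omega>, Z \<omega>))"
    using indep_source_destination unfolding indep_var_distribution_eq Z_def[abs_def] by blast
  \<comment> \<open>Off ties, the event that \<open>r\<close> wins is a condition on the pair of
    time vectors.\<close>
  have "(\<integral>\<^sup>+\<omega>. h (source_times \<omega>) * indicator {\<omega> \<in> space M. winner \<omega> = r} \<omega> \<partial>M) =
      (\<integral>\<^sup>+\<omega>. ?g (source_times \<omega>, Z \<omega>) \<partial>M)"
    using AE_winner_iff[OF r] AE_space
    by (intro nn_integral_cong_AE, eventually_elim)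
       (use r in \<open>auto simp: indicator_def Z_def\<close>)
  also have "\<dots> = (\<integral>\<^sup>+p. ?g p \<partial>(distr M times_space source_times \<Otimes>\<^sub>M distr M times_space Z))"
    unfolding eq
  proof (rule nn_integral_distr[symmetric, where f = ?g])
    show "(\<lambda>\<omega>. (source_times \<omega>, Z \<omega>)) \<in> measurable M (times_space \<Otimes>\<^sub>M times_space)"
      by measurable
  qed (simp add: g)
  also have "\<dots> = (\<integral>\<^sup>+y. \<integral>\<^sup>+z. ?g (y, z) \<partial>distr M times_space Z \<partial>distr M times_space source_times)"
  proof (rule DZ.nn_integral_fst[symmetric, where f = ?g])
    show "?g \<in> borel_measurable (distr M times_space source_times \<Otimes>\<^sub>M distr M times_space Z)"
      using g by (simp cong: measurable_cong_sets)
  qed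
  also have "\<dots> = (\<integral>\<^sup>+\<omega>. \<integral>\<^sup>+z. ?g (source_times \<omega>, z) \<partial>distr M times_space Z \<partial>M)"
  proof (rule nn_integral_distr)
    have "(\<lambda>y. \<integral>\<^sup>+z. ?g (y, z) \<partial>distr M times_space Z) \<in> borel_measurable times_space"
      by (rule DZ.borel_measurable_nn_integral_fst) (use g in \<open>simp cong: measurable_cong_sets\<close>)
    then show "(\<lambda>y. \<integral>\<^sup>+z. ?g (y, z) \<partial>distr M times_space Z)
        \<in> borel_measurable (distr M times_space source_times)"
      by simp
  qed (rule source_times_measurable)
  \<comment> \<open>For fixed source times the weight is a constant of the inner integral, and what
    remains is \<open>relay_success r\<close>.\<close>
  also have "\<dots> = (\<integral>\<^sup>+\<omega>. h (source_times \<omega>) * ennreal (relay_success r (source_times \<omega>)) \<partial>M)"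
  proof (intro nn_integral_cong)
    fix \<omega>
    let ?y = "source_times \<omega>"
    have [measurable]: "Measurable.pred times_space (?first ?y)"
      by measurable
    have "(\<integral>\<^sup>+z. ?g (?y, z) \<partial>distr M times_space Z) =
        (\<integral>\<^sup>+z. h ?y * indicator {z. ?first ?y z} z \<partial>distr M times_space Z)"
      by (intro nn_integral_cong) (simp add: indicator_def)
    also have "\<dots> = h ?y * ennreal (relay_success r ?y)"
      unfolding relay_success_eq_integral[OF r] Z_def[abs_def, symmetric]
      by (rule nn_integral_cmult) measurable
    finally show "(\<integral>\<^sup>+z. ?g (?y, z) \<partial>distr M times_space Z) = h ?y * ennreal (relay_success r ?y)" .
  qed
  finally show ?thesis by simp
qed

text \<open>Integrating a jointly measurable function over one factor leaves a measurable function
  of the other; nonnegativity permits the return from \<open>ennreal\<close> to the reals.\<close>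

lemma relay_success_measurable [measurable]:
  assumes r: "r \<in> relays"
  shows "relay_success r \<in> borel_measurable times_space"
proof -
  let ?first = "\<lambda>y z :: nat \<Rightarrow> real. \<forall>j\<in>relays - {r}. y r + z r < y j + z j"
  let ?D = "distr M times_space (\<lambda>\<omega>. \<lambda>r\<in>relays. Td r \<omega>)"
  interpret DZ: prob_space ?D
    by (rule prob_space_distr) (intro measurable_restrict Td_measurable)
  have [measurable]: "(\<lambda>y. y j) \<in> borel_measurable times_space" for j
    by (rule measurable_PiM_component_borel)
  have [measurable]: "Measurable.pred (times_space \<Otimes>\<^sub>M times_space) (\<lambda>p. ?first (fst p) (snd p))"
    by measurable
  have g: "(\<lambda>p. indicator {p. ?first (fst p) (snd p)} p :: ennreal)
      \<in> borel_measurable (times_space \<Otimes>\<^sub>M times_space)"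
    by measurable
  have "(\<lambda>y. \<integral>\<^sup>+z. indicator {p. ?first (fst p) (snd p)} (y, z) \<partial>?D) \<in> borel_measurable times_space"
    by (rule DZ.borel_measurable_nn_integral_fst) (use g in \<open>simp cong: measurable_cong_sets\<close>)
  also have "(\<lambda>y. \<integral>\<^sup>+z. indicator {p. ?first (fst p) (snd p)} (y, z) \<partial>?D) =
      (\<lambda>y. ennreal (relay_success r y))"
    unfolding relay_success_eq_integral[OF r] by (simp add: indicator_def[abs_def])
  finally have "(\<lambda>y. enn2real (ennreal (relay_success r y))) \<in> borel_measurable times_space"
    by measurable
  then show ?thesis by (simp add: relay_success_nonneg)
qed

section \<open>Cancelling the estimated probability\<close>

text \<open>Since \<open>X\<close> is a function of the source times, \<open>relay_success r\<close>
  may be exchanged for the event that \<open>r\<close> wins. On \<open>D\<close> this event is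
  \<open>A\<close>, and \<open>A\<close> may be exchanged for its conditional probability given
  \<open>X\<close>, which cancels the denominator. Agreement is asked on \<open>D\<close> only,
  because winning at rank \<open>i\<close> means that \<open>r\<close> wins just where
  \<open>r\<close> holds that rank.\<close>

lemma has_bochner_integral_relay_success_div:
  fixes \<xi> :: "(nat \<Rightarrow> real) \<Rightarrow> 'c" and X :: "'a \<Rightarrow> 'c"
  assumes r: "r \<in> relays" and A: "A \<in> events"
    and \<xi>[measurable]: "\<xi> \<in> measurable times_space K" and X: "\<And>\<omega>. X \<omega> = \<xi> (source_times \<omega>)"
    and D[measurable]: "D \<in> sets K"
    and A_iff: "\<And>\<omega>. \<omega> \<in> space M \<Longrightarrow> X \<omega> \<in> D \<Longrightarrow> \<omega> \<in> A \<longleftrightarrow> winner \<omega> = r"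
    and pos: "AE \<omega> in M. X \<omega> \<in> D \<longrightarrow> 0 < cond_prob_at M A K X (X \<omega>)"
  shows "has_bochner_integral M
    (\<lambda>\<omega>. indicator D (X \<omega>) * relay_success r (source_times \<omega>) / cond_prob_at M A K X (X \<omega>))
    (prob {\<omega> \<in> space M. X \<omega> \<in> D})"
proof -
  let ?p = "cond_prob_at M A K X"
  let ?h = "\<lambda>x. indicator D x * ennreal (1 / ?p x)"
  have XM[measurable]: "X \<in> measurable M K"
    using measurable_compose[OF source_times_measurable \<xi>] by (simp add: X[abs_def])
  note relay_success_measurable[OF r, measurable]
  \<comment> \<open>All factors are nonnegative, so the calculation runs in \<open>ennreal\<close>;
    integrability follows from the finite result.\<close>
  have "(\<integral>\<^sup>+\<omega>. ennreal (indicator D (X \<omega>) * relay_success r (source_times \<omega>) / ?p (X \<omega>)) \<partial>M) =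
      (\<integral>\<^sup>+\<omega>. ?h (\<xi> (source_times \<omega>)) * ennreal (relay_success r (source_times \<omega>)) \<partial>M)"
    by (intro nn_integral_cong)
       (auto simp: X indicator_def cond_prob_at_nonneg relay_success_nonneg simp flip: ennreal_mult)
  also have "\<dots> = (\<integral>\<^sup>+\<omega>. ?h (\<xi> (source_times \<omega>)) * indicator {\<omega> \<in> space M. winner \<omega> = r} \<omega> \<partial>M)"
    by (rule nn_integral_relay_success[OF r]) measurable
  also have "\<dots> = (\<integral>\<^sup>+\<omega>. ?h (X \<omega>) * indicator A \<omega> \<partial>M)"
    by (intro nn_integral_cong) (use A_iff in \<open>auto simp: indicator_def X\<close>)
  also have "\<dots> = (\<integral>\<^sup>+\<omega>. ?h (X \<omega>) * ennreal (?p (X \<omega>)) \<partial>M)"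
    by (rule nn_integral_cond_prob_at[OF A XM, symmetric]) measurable
  \<comment> \<open>Positivity on \<open>D\<close> makes the product of \<open>?p\<close> and its
    reciprocal 1 there; where \<open>?p\<close> is 0 the product would be 0 and mass would be
    lost.\<close>
  also have "\<dots> = (\<integral>\<^sup>+\<omega>. indicator {\<omega> \<in> space M. X \<omega> \<in> D} \<omega> \<partial>M)"
    using pos AE_space
    by (intro nn_integral_cong_AE, eventually_elim) (auto simp: indicator_def simp flip: ennreal_mult)
  also have "\<dots> = ennreal (prob {\<omega> \<in> space M. X \<omega> \<in> D})"
    by (subst nn_integral_indicator) (auto simp: emeasure_eq_measure)
  finally have "(\<integral>\<^sup>+\<omega>. ennreal (indicator D (X \<omega>) * relay_success r (source_times \<omega>) / ?p (X \<omega>)) \<partial>M) =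
    ennreal (prob {\<omega> \<in> space M. X \<omega> \<in> D})" .
  then show ?thesis
    by (intro has_bochner_integral_nn_integral)
       (auto simp: cond_prob_at_nonneg relay_success_nonneg)
qed

lemma contact_order_measurable [measurable]:
  "(\<lambda>\<omega>. contact_order \<omega> i) \<in> measurable M (count_space UNIV)"
  unfolding contact_order_eq by measurable

lemma wins_in_events: "wins i \<in> events"
proof -
  \<comment> \<open>The equality of two random relays is split over their countably many common
    values, each of which gives a measurable event.\<close>
  have "wins i = {\<omega> \<in> space M. \<exists>r. winner \<omega> = r \<and> contact_order \<omega> i = r}"
    by (auto simp: wins_def)
  also have "\<dots> \<in> events" by measurable
  finally show ?thesis .
qed

text \<open>The function \<open>c\<close> reads the i-th relay off the information \<open>X\<close>.
  Hence the event that \<open>r\<close> has rank \<open>i\<close> can be expressed through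
  \<open>X\<close>, and on it \<open>wins i\<close> is the event that \<open>r\<close> wins.\<close>

lemma has_bochner_integral_rank_share:
  fixes \<xi> :: "(nat \<Rightarrow> real) \<Rightarrow> 'c" and X :: "'a \<Rightarrow> 'c"
  assumes r: "r \<in> relays"
    and \<xi>: "\<xi> \<in> measurable times_space K" and X: "\<And>\<omega>. X \<omega> = \<xi> (source_times \<omega>)"
    and c[measurable]: "c \<in> measurable K (count_space UNIV)"
    and cX: "\<And>\<omega>. c (X \<omega>) = contact_order \<omega> i"
    and pos: "AE \<omega> in M. 0 < cond_prob_at M (wins i) K X (X \<omega>)"
  shows "has_bochner_integral M
    (\<lambda>\<omega>. of_bool (contact_order \<omega> i = r) * relay_success r (source_times \<omega>)
      / cond_prob_at M (wins i) K X (X \<omega>))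
    (prob {\<omega> \<in> space M. contact_order \<omega> i = r})"
proof -
  let ?D = "{x \<in> space K. c x = r}"
  have XM: "X \<in> measurable M K"
    using measurable_compose[OF source_times_measurable \<xi>] by (simp add: X[abs_def])
  have D: "X \<omega> \<in> ?D \<longleftrightarrow> contact_order \<omega> i = r" if "\<omega> \<in> space M" for \<omega>
    using measurable_space[OF XM that] by (simp add: cX)
  have "has_bochner_integral M
    (\<lambda>\<omega>. indicator ?D (X \<omega>) * relay_success r (source_times \<omega>) / cond_prob_at M (wins i) K X (X \<omega>))
    (prob {\<omega> \<in> space M. X \<omega> \<in> ?D})"
  proof (rule has_bochner_integral_relay_success_div[OF r wins_in_events \<xi> X])
    show "?D \<in> sets K" by measurable
    show "\<omega> \<in> wins i \<longleftrightarrow> winner \<omega> = r" if "\<omega> \<in> space M" "X \<omega> \<in> ?D" for \<omega>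
      using that D by (auto simp: wins_def)
    show "AE \<omega> in M. X \<omega> \<in> ?D \<longrightarrow> 0 < cond_prob_at M (wins i) K X (X \<omega>)"
      using pos by eventually_elim simp
  qed
  moreover have "{\<omega> \<in> space M. X \<omega> \<in> ?D} = {\<omega> \<in> space M. contact_order \<omega> i = r}"
    using D by blast
  moreover have "indicator ?D (X \<omega>) = (of_bool (contact_order \<omega> i = r) :: real)"
    if "\<omega> \<in> space M" for \<omega>
    using D[OF that] by (simp add: indicator_def)
  ultimately show ?thesis
    by (simp cong: has_bochner_integral_cong)
qed

section \<open>Summation over ranks\<close>

text \<open>The order is a bijection in every outcome, so exactly one rank belongs to
  \<open>r\<close> and the events partition the space.\<close>

lemma sum_prob_contact_order:
  assumes r: "r \<in> relays"
  shows "(\<Sum>i\<in>relays. prob {\<omega> \<in> space M. contact_order \<omega> i = r}) = 1"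
proof -
  have "(\<Sum>i\<in>relays. prob {\<omega> \<in> space M. contact_order \<omega> i = r}) =
      prob (\<Union>i\<in>relays. {\<omega> \<in> space M. contact_order \<omega> i = r})"
  proof (rule finite_measure_finite_Union[symmetric])
    show "disjoint_family_on (\<lambda>i. {\<omega> \<in> space M. contact_order \<omega> i = r}) relays"
      unfolding disjoint_family_on_def
      using inj_onD[OF bij_betw_imp_inj_on[OF bij_betw_contact_order]] by blast
  qed auto
  also have "(\<Union>i\<in>relays. {\<omega> \<in> space M. contact_order \<omega> i = r}) = space M"
  proof -
    have "\<exists>i\<in>relays. contact_order \<omega> i = r" for \<omega>
      using contact_order_surj[OF r] by metis
    then show ?thesis by blast
  qed
  finally show ?thesis by (simp add: prob_space)
qed

lemma sum_contact_order:
  fixes g :: "nat \<Rightarrow> real"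
  assumes r: "r \<in> relays" and m: "m \<in> relays" "contact_order \<omega> m = r"
  shows "(\<Sum>i\<in>relays. of_bool (contact_order \<omega> i = r) * g i) = g m"
proof -
  have "(\<Sum>i\<in>relays. of_bool (contact_order \<omega> i = r) * g i) =
      (\<Sum>i\<in>relays. if i = m then g i else 0)"
    using bij_betw_contact_order[of \<omega>] m
    by (intro sum.cong) (auto simp: bij_betw_def dest: inj_onD)
  then show ?thesis using m by simp
qed

text \<open>The integrand is the factor with which the cost of \<open>r\<close> enters the
  reward.\<close>

lemma has_bochner_integral_relay_share:
  assumes r: "r \<in> relays"
    and pos: "\<And>i. i \<in> relays \<Longrightarrow>
      AE \<omega> in M. 0 < estimated_prob k i (contact_time \<omega>) (contact_order \<omega>)"
  shows "has_bochner_integral M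
    (\<lambda>\<omega>. \<Sum>i\<in>relays. of_bool (contact_order \<omega> i = r) * relay_success r (source_times \<omega>)
      / estimated_prob k i (contact_time \<omega>) (contact_order \<omega>)) 1"
proof (cases "k = No_Info")
  case True
  \<comment> \<open>Positivity is assumed rank by rank, while the rank of \<open>r\<close> varies
    with the outcome. Joining the finitely many null sets makes it available at whichever rank
    \<open>r\<close> has.\<close>
  have "AE \<omega> in M. \<forall>i\<in>relays. 0 < q (contact_order \<omega> i) (contact_time \<omega> i)"
    using pos by (intro AE_finite_allI) (auto simp: True estimated_prob_def)
  then have q_pos: "AE \<omega> in M. 0 < q r (Ts r \<omega>)"
  proof eventually_elim
    case (elim \<omega>)
    obtain i where "i \<in> relays" "contact_order \<omega> i = r"
      using contact_order_surj[OF r] .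
    with elim show ?case by (metis contact_time_eq)
  qed
  have "has_bochner_integral M
    (\<lambda>\<omega>. indicator UNIV (Ts r \<omega>) * relay_success r (source_times \<omega>) / q r (Ts r \<omega>))
    (prob {\<omega> \<in> space M. Ts r \<omega> \<in> UNIV})"
    unfolding q_def
  proof (rule has_bochner_integral_relay_success_div[OF r, where \<xi> = "\<lambda>y. y r"])
    show "(\<lambda>y. y r) \<in> borel_measurable times_space" by (rule measurable_PiM_component_borel)
    show "AE \<omega> in M. Ts r \<omega> \<in> UNIV \<longrightarrow>
        0 < cond_prob_at M {\<omega> \<in> space M. winner \<omega> = r} borel (Ts r) (Ts r \<omega>)"
      using q_pos by (simp add: q_def)
  qed (use r in auto)
  \<comment> \<open>Only the term at the rank of \<open>r\<close> survives, and the estimate there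
    is \<open>q r (Ts r \<omega>)\<close> whatever that rank is.\<close>
  moreover have "(\<Sum>i\<in>relays. of_bool (contact_order \<omega> i = r) * relay_success r (source_times \<omega>)
      / estimated_prob k i (contact_time \<omega>) (contact_order \<omega>)) =
      relay_success r (source_times \<omega>) / q r (Ts r \<omega>)" for \<omega>
  proof -
    obtain m where m: "m \<in> relays" "contact_order \<omega> m = r"
      using contact_order_surj[OF r] .
    show ?thesis
      using sum_contact_order[OF r m, of "\<lambda>i. relay_success r (source_times \<omega>)
        / estimated_prob k i (contact_time \<omega>) (contact_order \<omega>)"] m
      by (simp add: True estimated_prob_def contact_time_eq)
  qed
  ultimately show ?thesis by (simp add: prob_space)
next
  case False
  note measurable_PiM_component_borel[measurable]
  have "has_bochner_integral M
    (\<lambda>\<omega>. of_bool (contact_order \<omega> i = r) * relay_success r (source_times \<omega>)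
      / estimated_prob k i (contact_time \<omega>) (contact_order \<omega>))
    (prob {\<omega> \<in> space M. contact_order \<omega> i = r})" if i: "i \<in> relays" for i
  proof -
    \<comment> \<open>\<open>contact_time\<close> is identified with a source time only at ranks in
      \<open>relays\<close>; \<open>i \<le> N\<close> secures this for all ranks up to
      \<open>i\<close>.\<close>
    have in_relays: "j \<in> relays" if "j \<in> {1..i}" for j using that i by auto
    have time: "restrict (contact_time \<omega>) {1..i} =
        (\<lambda>j\<in>{1..i}. source_times \<omega> (order_of (source_times \<omega>) j))" for \<omega>
      by (intro restrict_ext contact_time_eq_order_of in_relays)
    have order: "restrict (contact_order \<omega>) {1..i} =
        (\<lambda>j\<in>{1..i}. order_of (source_times \<omega>) j)" for \<omega>
      by (intro restrict_ext contact_order_eq)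
    have ith: "i \<in> {1..i}" using i by auto
    have ords: "(\<lambda>y. \<lambda>j\<in>{1..i}. order_of y j) \<in> measurable times_space (PiM {1..i} (\<lambda>_. count_space UNIV))"
      by (intro measurable_restrict order_of_measurable)
    have times: "(\<lambda>y. \<lambda>j\<in>{1..i}. y (order_of y j)) \<in> measurable times_space (PiM {1..i} (\<lambda>_. borel))"
      by (intro measurable_restrict nth_order_of_measurable)
    \<comment> \<open>The i-th relay is the last entry of the observed order. The second factor
      \<open>L\<close> is left open so as to serve both settings that reveal the identities of the
      predecessors.\<close>
    have fst_ith: "(\<lambda>p. fst p i) \<in> measurable (PiM {1..i} (\<lambda>_. count_space UNIV) \<Otimes>\<^sub>M L) (count_space UNIV)"
      for L :: "'z measure"
      by (rule measurable_compose[OF measurable_fst measurable_component_singleton[OF ith]])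
    show ?thesis
    proof (cases k)
      case Full
      show ?thesis
        unfolding estimated_prob_def Full info_setting.case
        by (rule has_bochner_integral_rank_share[OF r measurable_Pair[OF ords times] _ fst_ith])
           (use pos[OF i] ith in \<open>simp_all add: time order estimated_prob_def Full contact_order_eq\<close>)
    next
      case Partial_Ids
      show ?thesis
        unfolding estimated_prob_def Partial_Ids info_setting.case
        by (rule has_bochner_integral_rank_share[OF r measurable_Pair[OF ords nth_order_of_measurable] _ fst_ith])
           (use pos[OF i] ith in \<open>simp_all add: contact_time_eq_order_of[OF i] order
              estimated_prob_def Partial_Ids contact_order_eq\<close>)
    next
      case Partial_NoIds
      show ?thesis
        unfolding estimated_prob_def Partial_NoIds info_setting.case
        by (rule has_bochner_integral_rank_share[OF r
              measurable_Pair[OF order_of_measurable nth_order_of_measurable] _ measurable_fst])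
           (use pos[OF i] in \<open>simp_all add: contact_time_eq_order_of[OF i]
              estimated_prob_def Partial_NoIds contact_order_eq\<close>)
    qed (use False in simp)
  qed
  then have "has_bochner_integral M
    (\<lambda>\<omega>. \<Sum>i\<in>relays. of_bool (contact_order \<omega> i = r) * relay_success r (source_times \<omega>)
      / estimated_prob k i (contact_time \<omega>) (contact_order \<omega>))
    (\<Sum>i\<in>relays. prob {\<omega> \<in> space M. contact_order \<omega> i = r})"
    by (intro has_bochner_integral_sum)
  then show ?thesis by (simp add: sum_prob_contact_order[OF r])
qed

section \<open>The expected reward\<close>

text \<open>With the constant weight 1 no estimate enters; this handles the part of the reward that
  repays \<open>c_d\<close>.\<close>

lemma has_bochner_integral_relay_success:
  assumes r: "r \<in> relays"
  shows "has_bochner_integral M (\<lambda>\<omega>. relay_success r (source_times \<omega>))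
    (prob {\<omega> \<in> space M. winner \<omega> = r})"
proof (rule has_bochner_integral_nn_integral)
  show "(\<lambda>\<omega>. relay_success r (source_times \<omega>)) \<in> borel_measurable M"
    using relay_success_measurable[OF r] by measurable
  show "(\<integral>\<^sup>+\<omega>. ennreal (relay_success r (source_times \<omega>)) \<partial>M) =
      ennreal (prob {\<omega> \<in> space M. winner \<omega> = r})"
    using nn_integral_relay_success[OF r, of "\<lambda>_. 1"] by (simp add: emeasure_eq_measure)
qed (simp_all add: relay_success_nonneg)

lemma sum_prob_winner: "(\<Sum>r\<in>relays. prob {\<omega> \<in> space M. winner \<omega> = r}) = 1"
proof -
  have "(\<Sum>r\<in>relays. prob {\<omega> \<in> space M. winner \<omega> = r}) =
      prob (\<Union>r\<in>relays. {\<omega> \<in> space M. winner \<omega> = r})"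
    by (rule finite_measure_finite_Union[symmetric]) (auto simp: disjoint_family_on_def)
  also have "(\<Union>r\<in>relays. {\<omega> \<in> space M. winner \<omega> = r}) = space M"
    using winner_in by auto
  finally show ?thesis by (simp add: prob_space)
qed

text \<open>Costs belong to relays and not to ranks. After this regrouping they stand as constants
  before random sums, and the expectation can be taken relay by relay.\<close>

lemma expected_reward_given_eq:
  "expected_reward_given c_r c_s c_d k (contact_time \<omega>) (contact_order \<omega>) =
    (\<Sum>r\<in>relays. c_d * relay_success r (source_times \<omega>) + relay_cost c_r c_s r *
      (\<Sum>i\<in>relays. of_bool (contact_order \<omega> i = r) * relay_success r (source_times \<omega>)
        / estimated_prob k i (contact_time \<omega>) (contact_order \<omega>)))"
proof -
  let ?e = "\<lambda>i. estimated_prob k i (contact_time \<omega>) (contact_order \<omega>)"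
  let ?g = "\<lambda>r. relay_success r (source_times \<omega>)"
  let ?w = "\<lambda>i r. of_bool (contact_order \<omega> i = r) :: real"
  have "expected_reward_given c_r c_s c_d k (contact_time \<omega>) (contact_order \<omega>) =
      (\<Sum>i\<in>relays. ?g (contact_order \<omega> i) * (c_d + relay_cost c_r c_s (contact_order \<omega> i) / ?e i))"
    unfolding expected_reward_given_def reward_def by (intro sum.cong) (simp_all add: success_prob_eq)
  also have "\<dots> = (\<Sum>i\<in>relays. ?g (contact_order \<omega> i) * c_d) +
      (\<Sum>i\<in>relays. ?g (contact_order \<omega> i) * (relay_cost c_r c_s (contact_order \<omega> i) / ?e i))"
    by (simp add: ring_distribs sum.distrib)
  also have "(\<Sum>i\<in>relays. ?g (contact_order \<omega> i) * c_d) = (\<Sum>r\<in>relays. ?g r * c_d)"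
    by (rule sum.reindex_bij_betw[OF bij_betw_contact_order])
  \<comment> \<open>The estimate is tied to the rank, so the summand is not given by the relay
    alone. The indicator that \<open>r\<close> has rank \<open>i\<close> is inserted, and the two
    sums are exchanged afterwards.\<close>
  also have "(\<Sum>i\<in>relays. ?g (contact_order \<omega> i) * (relay_cost c_r c_s (contact_order \<omega> i) / ?e i)) =
      (\<Sum>i\<in>relays. \<Sum>r\<in>relays. relay_cost c_r c_s r * (?w i r * ?g r / ?e i))"
  proof (intro sum.cong refl)
    fix i assume i: "i \<in> relays"
    have "(\<Sum>r\<in>relays. relay_cost c_r c_s r * (?w i r * ?g r / ?e i)) =
        (\<Sum>r\<in>relays. if r = contact_order \<omega> i then relay_cost c_r c_s r * (?g r / ?e i) else 0)"
      by (intro sum.cong) auto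
    also have "\<dots> = ?g (contact_order \<omega> i) * (relay_cost c_r c_s (contact_order \<omega> i) / ?e i)"
      using contact_order_in[OF i, of \<omega>] by simp
    finally show "?g (contact_order \<omega> i) * (relay_cost c_r c_s (contact_order \<omega> i) / ?e i) =
        (\<Sum>r\<in>relays. relay_cost c_r c_s r * (?w i r * ?g r / ?e i))" ..
  qed
  also have "\<dots> = (\<Sum>r\<in>relays. relay_cost c_r c_s r * (\<Sum>i\<in>relays. ?w i r * ?g r / ?e i))"
    by (subst sum.swap) (simp add: sum_distrib_left)
  finally show ?thesis by (simp add: sum.distrib mult.commute)
qed

text \<open>The winning probabilities of the relays add up to 1, which leaves a single
  \<open>c_d\<close>, and the cost of each relay carries total weight 1.\<close>

lemma has_bochner_integral_expected_reward:
  assumes pos: "\<And>i. i \<in> relays \<Longrightarrow>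
      AE \<omega> in M. 0 < estimated_prob k i (contact_time \<omega>) (contact_order \<omega>)"
  shows "has_bochner_integral M
    (\<lambda>\<omega>. expected_reward_given c_r c_s c_d k (contact_time \<omega>) (contact_order \<omega>))
    (c_d + (\<Sum>r\<in>relays. relay_cost c_r c_s r))"
proof -
  have "has_bochner_integral M
    (\<lambda>\<omega>. expected_reward_given c_r c_s c_d k (contact_time \<omega>) (contact_order \<omega>))
    (\<Sum>r\<in>relays. c_d * prob {\<omega> \<in> space M. winner \<omega> = r} + relay_cost c_r c_s r * 1)"
    unfolding expected_reward_given_eq
    by (intro has_bochner_integral_sum has_bochner_integral_add has_bochner_integral_mult_right
        has_bochner_integral_relay_success has_bochner_integral_relay_share pos)
  also have "(\<Sum>r\<in>relays. c_d * prob {\<omega> \<in> space M. winner \<omega> = r} + relay_cost c_r c_s r * 1) =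
      c_d + (\<Sum>r\<in>relays. relay_cost c_r c_s r)"
    by (simp add: sum.distrib sum_prob_winner flip: sum_distrib_left)
  finally show ?thesis .
qed

end

theorem theorem2:
  fixes M :: "'a measure" and P :: "'b measure" and N :: nat
    and ICs ICd :: "nat \<Rightarrow> 'b \<Rightarrow> real" and Ts Td :: "nat \<Rightarrow> 'a \<Rightarrow> real"
    and c_r c_s c_d :: real and k :: info_setting
    and S :: "'a \<Rightarrow> nat \<Rightarrow> real" and \<Lambda> :: "'a \<Rightarrow> nat \<Rightarrow> nat"
    and R :: "(nat \<Rightarrow> real) \<Rightarrow> (nat \<Rightarrow> nat) \<Rightarrow> real"
  defines "S \<equiv> two_hop_network.contact_time N Ts"
    and "\<Lambda> \<equiv> two_hop_network.contact_order N Ts"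
    and "R \<equiv> two_hop_network.expected_reward_given M N Ts Td c_r c_s c_d k"
  assumes network: "two_hop_network M P N ICs ICd Ts Td"
    and rewards_defined: "\<And>i. i \<in> {1..N} \<Longrightarrow>
      AE \<omega> in M. 0 < two_hop_network.estimated_prob M N Ts Td k i (S \<omega>) (\<Lambda> \<omega>)"
  shows "integrable M (\<lambda>\<omega>. R (S \<omega>) (\<Lambda> \<omega>)) \<and>
    (\<integral>\<omega>. R (S \<omega>) (\<Lambda> \<omega>) \<partial>M) = c_d + (\<Sum>r=1..N. c_r + c_s * (\<integral>\<omega>. Td r \<omega> \<partial>M))"
proof -
  interpret two_hop_network M P N ICs ICd Ts Td by (rule network)
  have "has_bochner_integral M (\<lambda>\<omega>. R (S \<omega>) (\<Lambda> \<omega>)) (c_d + (\<Sum>r=1..N. relay_cost c_r c_s r))"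
    unfolding R_def S_def \<Lambda>_def
    by (rule has_bochner_integral_expected_reward) (rule rewards_defined[unfolded S_def \<Lambda>_def])
  then show ?thesis
    by (simp add: has_bochner_integral_iff relay_cost_def)
qed

end
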